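(* Let $L$ be a measurable locale. Then there exists a locally compact Hausdorff space $X$ together with a regular content $\lambda$ on $X$ such that $L\cong X^\lambda$ as locales.
   Context: A frame is a poset with arbitrary suprema and finite infima satisfying $V\wedge\bigvee_i U_i=\bigvee_i(V\wedge U_i)$; locales are the objects of the opposite category of frames, and $\mathcal{O}(L)$ is the frame of $L$. A measure on $L$ is a monotone map $\nu:\mathcal{O}(L)\to[0,\infty]$ with $\nu(0)=0$, $\nu(U)+\nu(V)=\nu(U\vee V)+\nu(U\wedge V)$, and $\nu(\bigvee_iU_i)=\sup_i\nu(U_i)$ for directed families. It is locally finite if $1$ is a supremum of opens of finite measure, and faithful if whenever $U\le V$ and $\nu(U\wedge K)=\nu(V\wedge K)$ for all $K$ with $\nu(K)<\infty$, then $U=V$. A locale is Boolean if every open has a complement. A Boolean locale is measurable if it admits a locally finite and faithful measure. $\mathcal{K}(X)$ is the lattice of compact subsets of $X$. A content is a function $\lambda:\mathcal{K}(X)\to[0,+\infty)$ that is monotone, subadditive ($\lambda(C\cup D)\le\lambda(C)+\lambda(D)$), and additive on disjoint pairs. Write $K_1\ll K_2$ if there is an open $U$ with $K_1\subset U\subset K_2$. A content is regular if $\lambda(K)=\inf\{\lambda(K')\mid K\ll K',\ K'\text{ compact}\}$ for all compact $K$ (infimum in $[0,+\infty]$). On a Hausdorff space a regular content is modular: $\lambda(C)+\lambda(D)=\lambda(C\cup D)+\lambda(C\cap D)$. A $\lambda$-ideal is a downward closed $U\subset\mathcal{K}(X)$ such that $K\in U$ whenever there are $K_i\in U$ $(i\in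 I)$, $K_i\subset K$, such that for all $\epsilon>0$ some finite $F\subset I$ has $\lambda(K)-\lambda(\bigcup_{i\in F}K_i)<\epsilon$. The $\lambda$-ideals ordered by inclusion form a frame; $X^\lambda$ is the corresponding locale. *)

theory Defs
  imports "HOL-Analysis.Analysis" "HOL-Algebra.Complete_Lattice"
begin

section \<open>Frames and locales\<close>

text \<open>
  A locale (in the sense of point-free topology) is given by its frame of opens, represented as an
  order with a carrier; \<open>partial_order\<close> forces the equivalence of the record to be equality.
\<close>

locale frame = complete_lattice L for L (structure) +
  assumes meet_Sup_distrib:
    "\<lbrakk>V \<in> carrier L; A \<subseteq> carrier L\<rbrakk> \<Longrightarrow> V \<sqinter> \<Squnion>A = \<Squnion>((\<lambda>U. V \<sqinter> U) ` A)"

definition frame_hom :: "('a, 'c) gorder_scheme \<Rightarrow> ('b, 'd) gorder_scheme \<Rightarrow> ('a \<Rightarrow> 'b) set" where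
  "frame_hom A B =
     {h \<in> carrier A \<rightarrow> carrier B. sup_pres A B h \<and> meet_pres A B h \<and> h \<top>\<^bsub>A\<^esub> = \<top>\<^bsub>B\<^esub>}"

text \<open>
  The category of locales is the opposite of the category of frames, so a morphism \<open>L \<rightarrow> M\<close>
  is a frame homomorphism from the opens of \<open>M\<close> to the opens of \<open>L\<close>.
\<close>

definition locale_mor :: "('a, 'c) gorder_scheme \<Rightarrow> ('b, 'd) gorder_scheme \<Rightarrow> ('b \<Rightarrow> 'a) set" where
  "locale_mor L M = frame_hom M L"

definition locale_iso :: "('a, 'c) gorder_scheme \<Rightarrow> ('b, 'd) gorder_scheme \<Rightarrow> bool" where
  "locale_iso L M \<longleftrightarrow> frame L \<and> frame M \<and>
     (\<exists>f \<in> locale_mor L M. \<exists>g \<in> locale_mor M L.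
        (\<forall>U \<in> carrier L. f (g U) = U) \<and> (\<forall>V \<in> carrier M. g (f V) = V))"

definition boolean_locale :: "('a, 'c) gorder_scheme \<Rightarrow> bool" where
  "boolean_locale L \<longleftrightarrow> frame L \<and>
     (\<forall>U \<in> carrier L. \<exists>V \<in> carrier L. U \<sqinter>\<^bsub>L\<^esub> V = \<bottom>\<^bsub>L\<^esub> \<and> U \<squnion>\<^bsub>L\<^esub> V = \<top>\<^bsub>L\<^esub>)"


section \<open>Measures on locales\<close>

definition directed_in :: "('a, 'c) gorder_scheme \<Rightarrow> 'a set \<Rightarrow> bool" where
  "directed_in L A \<longleftrightarrow> A \<subseteq> carrier L \<and> A \<noteq> {} \<and>
     (\<forall>U \<in> A. \<forall>V \<in> A. \<exists>W \<in> A. U \<sqsubseteq>\<^bsub>L\<^esub> W \<and> V \<sqsubseteq>\<^bsub>L\<^esub> W)"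

definition locale_measure :: "('a, 'c) gorder_scheme \<Rightarrow> ('a \<Rightarrow> ennreal) \<Rightarrow> bool" where
  "locale_measure L \<nu> \<longleftrightarrow>
     (\<forall>U \<in> carrier L. \<forall>V \<in> carrier L. U \<sqsubseteq>\<^bsub>L\<^esub> V \<longrightarrow> \<nu> U \<le> \<nu> V) \<and>
     \<nu> \<bottom>\<^bsub>L\<^esub> = 0 \<and>
     (\<forall>U \<in> carrier L. \<forall>V \<in> carrier L. \<nu> U + \<nu> V = \<nu> (U \<squnion>\<^bsub>L\<^esub> V) + \<nu> (U \<sqinter>\<^bsub>L\<^esub> V)) \<and>
     (\<forall>A. directed_in L A \<longrightarrow> \<nu> (\<Squnion>\<^bsub>L\<^esub>A) = (SUP U\<in>A. \<nu> U))"

definition locally_finite_measure :: "('a, 'c) gorder_scheme \<Rightarrow> ('a \<Rightarrow> ennreal) \<Rightarrow> bool" where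
  "locally_finite_measure L \<nu> \<longleftrightarrow>
     (\<exists>A \<subseteq> carrier L. (\<forall>U \<in> A. \<nu> U < \<infinity>) \<and> \<Squnion>\<^bsub>L\<^esub>A = \<top>\<^bsub>L\<^esub>)"

definition faithful_measure :: "('a, 'c) gorder_scheme \<Rightarrow> ('a \<Rightarrow> ennreal) \<Rightarrow> bool" where
  "faithful_measure L \<nu> \<longleftrightarrow>
     (\<forall>U \<in> carrier L. \<forall>V \<in> carrier L.
        U \<sqsubseteq>\<^bsub>L\<^esub> V \<and> (\<forall>K \<in> carrier L. \<nu> K < \<infinity> \<longrightarrow> \<nu> (U \<sqinter>\<^bsub>L\<^esub> K) = \<nu> (V \<sqinter>\<^bsub>L\<^esub> K)) \<longrightarrow> U = V)"

definition measurable_locale :: "('a, 'c) gorder_scheme \<Rightarrow> bool" where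
  "measurable_locale L \<longleftrightarrow> boolean_locale L \<and>
     (\<exists>\<nu>. locale_measure L \<nu> \<and> locally_finite_measure L \<nu> \<and> faithful_measure L \<nu>)"


section \<open>Contents\<close>

text \<open>
  A content on \<open>X\<close> is a function on the compact subsets of \<open>X\<close>; here it is a total function on sets
  whose values on non-compact sets are irrelevant.
\<close>

definition content_on :: "'a topology \<Rightarrow> ('a set \<Rightarrow> real) \<Rightarrow> bool" where
  "content_on X \<mu> \<longleftrightarrow>
     (\<forall>C. compactin X C \<longrightarrow> 0 \<le> \<mu> C) \<and>
     (\<forall>C D. compactin X C \<and> compactin X D \<and> C \<subseteq> D \<longrightarrow> \<mu> C \<le> \<mu> D) \<and>
     (\<forall>C D. compactin X C \<and> compactin X D \<longrightarrow> \<mu> (C \<union> D) \<le> \<mu> C + \<mu> D) \<and>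
     (\<forall>C D. compactin X C \<and> compactin X D \<and> C \<inter> D = {} \<longrightarrow> \<mu> (C \<union> D) = \<mu> C + \<mu> D)"

definition way_inside :: "'a topology \<Rightarrow> 'a set \<Rightarrow> 'a set \<Rightarrow> bool" where
  "way_inside X C D \<longleftrightarrow> (\<exists>U. openin X U \<and> C \<subseteq> U \<and> U \<subseteq> D)"

text \<open>
  The infimum is taken in \<open>ennreal\<close>, so that it is \<open>\<infinity>\<close> when there is no compact \<open>D\<close> as required.
\<close>

definition regular_content :: "'a topology \<Rightarrow> ('a set \<Rightarrow> real) \<Rightarrow> bool" where
  "regular_content X \<mu> \<longleftrightarrow> content_on X \<mu> \<and>
     (\<forall>C. compactin X C \<longrightarrow>
        ennreal (\<mu> C) = (INF D \<in> {D. compactin X D \<and> way_inside X C D}. ennreal (\<mu> D)))"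

text \<open>
  The families \<open>(K\<^sub>i)\<close> in the closure condition are represented by their sets of members \<open>S\<close>;
  for empty \<open>S\<close> the condition says that compact sets of content \<open>0\<close> belong to every such ideal.
\<close>

definition content_ideal :: "'a topology \<Rightarrow> ('a set \<Rightarrow> real) \<Rightarrow> 'a set set \<Rightarrow> bool" where
  "content_ideal X \<mu> I \<longleftrightarrow>
     I \<subseteq> {K. compactin X K} \<and>
     (\<forall>K \<in> I. \<forall>C. compactin X C \<and> C \<subseteq> K \<longrightarrow> C \<in> I) \<and>
     (\<forall>K S. compactin X K \<and> S \<subseteq> I \<and> (\<forall>C \<in> S. C \<subseteq> K) \<and>
        (\<forall>\<epsilon>>0. \<exists>F. finite F \<and> F \<subseteq> S \<and> \<mu> K - \<mu> (\<Union>F) < \<epsilon>) \<longrightarrow> K \<in> I)"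

definition content_locale :: "'a topology \<Rightarrow> ('a set \<Rightarrow> real) \<Rightarrow> 'a set set gorder" where
  "content_locale X \<mu> = \<lparr>carrier = {I. content_ideal X \<mu> I}, eq = (=), le = (\<subseteq>)\<rparr>"

end

theory Submission
  imports Defs
begin

text \<open>
  The space is the Stone space of the Boolean ring of elements of finite measure. Its points are
  the ultrafilters of \<open>L\<close> that contain an element of finite measure, and its topology has
  as basis the sets \<open>clopen U\<close> of the points that contain \<open>U\<close>. Local finiteness of the measure makes
  \<open>U \<mapsto> clopen U\<close> an embedding of the Boolean algebra \<open>L\<close> into the clopen sets, so that finite
  Boolean computations in \<open>L\<close> become computations with sets. The sets \<open>clopen A\<close> with \<open>A\<close> of finite
  measure are compact (\<open>compactin_clopen\<close>) and separate the points from each other and from compact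
  sets (\<open>separating_clopen\<close>, \<open>compact_separation\<close>); hence the space is locally compact and Hausdorff.

  A compact set \<open>K\<close> differs from a clopen set only by a nowhere dense set: since \<open>L\<close> is complete there is a
  largest \<open>U\<close> with \<open>clopen U \<subseteq> K\<close>, here called \<open>core K\<close>, and it is also the infimum of all \<open>W\<close>
  with \<open>K \<subseteq> clopen W\<close>. The content of \<open>K\<close> is the measure of \<open>core K\<close>. The map \<open>core\<close>
  preserves binary meets because it is given by largest clopen subsets, and it preserves binary joins
  because a nonempty open subset of \<open>K \<union> K'\<close> meets the interior of \<open>K\<close> or of \<open>K'\<close>
  (\<open>core_Int\<close>, \<open>core_Un\<close>). So the content is modular. It is regular because the measure, being continuous
  along directed suprema, is continuous along the downward directed infimum \<open>core K\<close> of
  elements of finite measure (\<open>INF_clopen_le_\<nu>_core\<close>).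

  Finally \<open>U \<mapsto> {K. core K \<sqsubseteq> U}\<close> and \<open>J \<mapsto> \<Squnion>(core ` J)\<close> are mutually inverse monotone maps between \<open>L\<close>
  and the content ideals. The closure condition on ideals matches suprema in \<open>L\<close> in both directions:
  a faithful measure detects an inequality \<open>core K \<sqsubseteq> U\<close> by the measure of \<open>core K \<sqinter> -U\<close>
  (\<open>content_ideal_ideal_of\<close>), and if \<open>core K\<close> lies below the supremum of the cores of an ideal, then frame
  distributivity and continuity of the measure exhaust \<open>K\<close> in content by members of the ideal inside \<open>K\<close>
  (\<open>ideal_of_Sup_core\<close>). An order isomorphism preserves all suprema and finite infima, so it is an
  isomorphism of locales.
\<close>

section \<open>Order isomorphisms and isomorphisms of locales\<close>

text \<open>
  Mutually inverse monotone maps are adjoint to each other on both sides, so each of them preserves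
  all existing suprema and infima.
\<close>
lemma order_iso_imp_frame_hom:
  assumes A: "complete_lattice A" and B: "complete_lattice B"
    and h: "h \<in> carrier A \<rightarrow> carrier B" and k: "k \<in> carrier B \<rightarrow> carrier A"
    and kh: "\<And>x. x \<in> carrier A \<Longrightarrow> k (h x) = x"
    and hk: "\<And>y. y \<in> carrier B \<Longrightarrow> h (k y) = y"
    and h_mono: "\<And>x x'. \<lbrakk>x \<in> carrier A; x' \<in> carrier A; x \<sqsubseteq>\<^bsub>A\<^esub> x'\<rbrakk> \<Longrightarrow> h x \<sqsubseteq>\<^bsub>B\<^esub> h x'"
    and k_mono: "\<And>y y'. \<lbrakk>y \<in> carrier B; y' \<in> carrier B; y \<sqsubseteq>\<^bsub>B\<^esub> y'\<rbrakk> \<Longrightarrow> k y \<sqsubseteq>\<^bsub>A\<^esub> k y'"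
  shows "h \<in> frame_hom A B"
proof -
  interpret A: complete_lattice A by fact
  interpret B: complete_lattice B by fact
  have adj: "h x \<sqsubseteq>\<^bsub>B\<^esub> y \<longleftrightarrow> x \<sqsubseteq>\<^bsub>A\<^esub> k y" "y \<sqsubseteq>\<^bsub>B\<^esub> h x \<longleftrightarrow> k y \<sqsubseteq>\<^bsub>A\<^esub> x"
    if "x \<in> carrier A" "y \<in> carrier B" for x y
    using h_mono[of x "k y"] k_mono[of "h x" y] h_mono[of "k y" x] k_mono[of y "h x"]
      that h k kh hk by (auto simp: Pi_iff)
  have "h (\<Squnion>\<^bsub>A\<^esub>S) = \<Squnion>\<^bsub>B\<^esub>(h ` S)" if S: "S \<subseteq> carrier A" for S
  proof (rule B.le_antisym)
    have hS: "h ` S \<subseteq> carrier B" using S h by auto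
    show "h (\<Squnion>\<^bsub>A\<^esub>S) \<sqsubseteq>\<^bsub>B\<^esub> \<Squnion>\<^bsub>B\<^esub>(h ` S)"
    proof (subst adj)
      show "\<Squnion>\<^bsub>A\<^esub>S \<sqsubseteq>\<^bsub>A\<^esub> k (\<Squnion>\<^bsub>B\<^esub>(h ` S))"
      proof (rule A.sup_least[OF S])
        fix x assume "x \<in> S"
        then have "h x \<sqsubseteq>\<^bsub>B\<^esub> \<Squnion>\<^bsub>B\<^esub>(h ` S)" using hS by (intro B.sup_upper) auto
        then show "x \<sqsubseteq>\<^bsub>A\<^esub> k (\<Squnion>\<^bsub>B\<^esub>(h ` S))" using adj S \<open>x \<in> S\<close> hS by auto
      qed (use hS k in auto)
    qed (use S hS in auto)
    show "\<Squnion>\<^bsub>B\<^esub>(h ` S) \<sqsubseteq>\<^bsub>B\<^esub> h (\<Squnion>\<^bsub>A\<^esub>S)"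
      using hS S h by (intro B.sup_least) (auto intro!: h_mono A.sup_upper)
  qed (use S h in \<open>auto intro!: B.sup_closed\<close>)
  moreover have "h (x \<sqinter>\<^bsub>A\<^esub> y) = h x \<sqinter>\<^bsub>B\<^esub> h y" if "x \<in> carrier A" "y \<in> carrier A" for x y
  proof (rule B.le_antisym)
    have hc: "h x \<in> carrier B" "h y \<in> carrier B" using that h by auto
    show "h (x \<sqinter>\<^bsub>A\<^esub> y) \<sqsubseteq>\<^bsub>B\<^esub> h x \<sqinter>\<^bsub>B\<^esub> h y"
      using that h by (intro B.meet_le h_mono A.meet_left A.meet_right) auto
    have "k (h x \<sqinter>\<^bsub>B\<^esub> h y) \<sqsubseteq>\<^bsub>A\<^esub> x \<sqinter>\<^bsub>A\<^esub> y"
      using that hc k adj(2)[of x "h x \<sqinter>\<^bsub>B\<^esub> h y"] adj(2)[of y "h x \<sqinter>\<^bsub>B\<^esub> h y"]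
        B.meet_left[of "h x" "h y"] B.meet_right[of "h x" "h y"]
      by (intro A.meet_le) auto
    then show "h x \<sqinter>\<^bsub>B\<^esub> h y \<sqsubseteq>\<^bsub>B\<^esub> h (x \<sqinter>\<^bsub>A\<^esub> y)" using that hc adj(2) by simp
  qed (use that h in \<open>auto simp: Pi_iff\<close>)
  moreover have "h \<top>\<^bsub>A\<^esub> = \<top>\<^bsub>B\<^esub>"
  proof (rule B.le_antisym)
    show "\<top>\<^bsub>B\<^esub> \<sqsubseteq>\<^bsub>B\<^esub> h \<top>\<^bsub>A\<^esub>" using adj(2) k by auto
  qed (use h in auto)
  ultimately show ?thesis
    using A B h by (simp add: frame_hom_def sup_pres_def meet_pres_def A.lattice_axioms B.lattice_axioms)
qed

text \<open>
  Completeness and frame distributivity are order-theoretic, so they are transported along the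
  isomorphism: \<open>M\<close> is a frame because \<open>L\<close> is one.
\<close>
lemma locale_iso_if_order_iso:
  assumes L: "frame L" and M: "partial_order M"
    and h: "h \<in> carrier L \<rightarrow> carrier M" and k: "k \<in> carrier M \<rightarrow> carrier L"
    and kh: "\<And>x. x \<in> carrier L \<Longrightarrow> k (h x) = x"
    and hk: "\<And>y. y \<in> carrier M \<Longrightarrow> h (k y) = y"
    and h_mono: "\<And>x x'. \<lbrakk>x \<in> carrier L; x' \<in> carrier L; x \<sqsubseteq>\<^bsub>L\<^esub> x'\<rbrakk> \<Longrightarrow> h x \<sqsubseteq>\<^bsub>M\<^esub> h x'"
    and k_mono: "\<And>y y'. \<lbrakk>y \<in> carrier M; y' \<in> carrier M; y \<sqsubseteq>\<^bsub>M\<^esub> y'\<rbrakk> \<Longrightarrow> k y \<sqsubseteq>\<^bsub>L\<^esub> k y'"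
  shows "locale_iso L M"
proof -
  interpret L: frame L by fact
  interpret M: partial_order M by fact
  have adj: "h x \<sqsubseteq>\<^bsub>M\<^esub> y \<longleftrightarrow> x \<sqsubseteq>\<^bsub>L\<^esub> k y" "y \<sqsubseteq>\<^bsub>M\<^esub> h x \<longleftrightarrow> k y \<sqsubseteq>\<^bsub>L\<^esub> x"
    if "x \<in> carrier L" "y \<in> carrier M" for x y
    using h_mono[of x "k y"] k_mono[of "h x" y] h_mono[of "k y" x] k_mono[of y "h x"]
      that h k kh hk by (auto simp: Pi_iff)
  have M_complete: "complete_lattice M"
  proof (rule M.complete_latticeI)
    fix S assume S: "S \<subseteq> carrier M"
    then have kS: "k ` S \<subseteq> carrier L" using k by auto
    have "least M (h (\<Squnion>\<^bsub>L\<^esub>(k ` S))) (Upper M S)"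
    proof (rule least_UpperI)
      fix y assume "y \<in> S"
      then have "k y \<sqsubseteq>\<^bsub>L\<^esub> \<Squnion>\<^bsub>L\<^esub>(k ` S)" using kS by (intro L.sup_upper) auto
      then show "y \<sqsubseteq>\<^bsub>M\<^esub> h (\<Squnion>\<^bsub>L\<^esub>(k ` S))" using adj(2) S kS \<open>y \<in> S\<close> by auto
    next
      fix y assume y: "y \<in> Upper M S"
      then have "\<Squnion>\<^bsub>L\<^esub>(k ` S) \<sqsubseteq>\<^bsub>L\<^esub> k y"
        using kS k S by (intro L.sup_least) (auto simp: Upper_def intro!: k_mono)
      then show "h (\<Squnion>\<^bsub>L\<^esub>(k ` S)) \<sqsubseteq>\<^bsub>M\<^esub> y" using adj(1) kS y by (auto simp: Upper_def)
    qed (use S kS h in auto)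
    then show "\<exists>s. least M s (Upper M S)" ..
    have "greatest M (h (\<Sqinter>\<^bsub>L\<^esub>(k ` S))) (Lower M S)"
    proof (rule greatest_LowerI)
      fix y assume "y \<in> S"
      then have "\<Sqinter>\<^bsub>L\<^esub>(k ` S) \<sqsubseteq>\<^bsub>L\<^esub> k y" using kS by (intro L.inf_lower) auto
      then show "h (\<Sqinter>\<^bsub>L\<^esub>(k ` S)) \<sqsubseteq>\<^bsub>M\<^esub> y" using adj(1) S kS \<open>y \<in> S\<close> by auto
    next
      fix y assume y: "y \<in> Lower M S"
      then have "k y \<sqsubseteq>\<^bsub>L\<^esub> \<Sqinter>\<^bsub>L\<^esub>(k ` S)"
        using kS k S by (intro L.inf_greatest) (auto simp: Lower_def intro!: k_mono)
      then show "y \<sqsubseteq>\<^bsub>M\<^esub> h (\<Sqinter>\<^bsub>L\<^esub>(k ` S))" using adj(2) kS y by (auto simp: Lower_def)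
    qed (use S kS h in auto)
    then show "\<exists>i. greatest M i (Lower M S)" ..
  qed
  then interpret M: complete_lattice M .
  have hom: "h \<in> frame_hom L M" "k \<in> frame_hom M L"
    by (rule order_iso_imp_frame_hom[where k = k] order_iso_imp_frame_hom[where k = h],
        (fact | rule L.complete_lattice_axioms)+)+
  have "frame M"
  proof unfold_locales
    fix V S assume V: "V \<in> carrier M" and S: "S \<subseteq> carrier M"
    have kS: "k ` S \<subseteq> carrier L" and kV: "k V \<in> carrier L" using S V k by auto
    have "V \<sqinter>\<^bsub>M\<^esub> \<Squnion>\<^bsub>M\<^esub>S = h (k V \<sqinter>\<^bsub>L\<^esub> \<Squnion>\<^bsub>L\<^esub>(k ` S))"
      using hom V S kS kV hk by (simp add: frame_hom_def sup_pres_def meet_pres_def image_image subset_iff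
          cong: image_cong)
    also have "\<dots> = h (\<Squnion>\<^bsub>L\<^esub>((\<lambda>U. k V \<sqinter>\<^bsub>L\<^esub> U) ` k ` S))" using L.meet_Sup_distrib[OF kV kS] by simp
    also have "\<dots> = \<Squnion>\<^bsub>M\<^esub>(h ` (\<lambda>U. k V \<sqinter>\<^bsub>L\<^esub> U) ` k ` S)"
    proof -
      have "(\<lambda>U. k V \<sqinter>\<^bsub>L\<^esub> U) ` k ` S \<subseteq> carrier L" using kV kS by auto
      then show ?thesis using hom by (simp add: frame_hom_def sup_pres_def)
    qed
    also have "h ` (\<lambda>U. k V \<sqinter>\<^bsub>L\<^esub> U) ` k ` S = (\<lambda>U. V \<sqinter>\<^bsub>M\<^esub> U) ` S"
    proof -
      have "h (k V \<sqinter>\<^bsub>L\<^esub> k U) = V \<sqinter>\<^bsub>M\<^esub> U" if "U \<in> S" for U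
      proof -
        have "U \<in> carrier M" "k U \<in> carrier L" using that S kS by auto
        then show ?thesis using hom(1) kV hk V by (simp add: frame_hom_def meet_pres_def)
      qed
      then show ?thesis by (simp add: image_image)
    qed
    finally show "V \<sqinter>\<^bsub>M\<^esub> \<Squnion>\<^bsub>M\<^esub>S = \<Squnion>\<^bsub>M\<^esub>((\<lambda>U. V \<sqinter>\<^bsub>M\<^esub> U) ` S)" .
  qed
  with L hom kh hk show ?thesis unfolding locale_iso_def locale_mor_def by blast
qed

section \<open>Boolean frames\<close>

lemma (in frame) meet_join_distrib:
  assumes "U \<in> carrier L" "V \<in> carrier L" "W \<in> carrier L"
  shows "U \<sqinter> (V \<squnion> W) = (U \<sqinter> V) \<squnion> (U \<sqinter> W)"
  using assms meet_Sup_distrib[of U "{V, W}"] by (simp add: join_def)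

locale boolean_frame = frame L for L (structure) +
  assumes complemented: "U \<in> carrier L \<Longrightarrow> \<exists>V\<in>carrier L. U \<sqinter> V = \<bottom> \<and> U \<squnion> V = \<top>"
begin

definition neg :: "'a \<Rightarrow> 'a" where
  "neg U = (SOME V. V \<in> carrier L \<and> U \<sqinter> V = \<bottom> \<and> U \<squnion> V = \<top>)"

lemma neg:
  assumes "U \<in> carrier L"
  shows neg_closed [simp]: "neg U \<in> carrier L"
    and meet_neg: "U \<sqinter> neg U = \<bottom>" and join_neg: "U \<squnion> neg U = \<top>"
  using someI_ex[of "\<lambda>V. V \<in> carrier L \<and> U \<sqinter> V = \<bottom> \<and> U \<squnion> V = \<top>"] complemented[OF assms]
  unfolding neg_def by blast+

lemma le_bottomD: "\<lbrakk>U \<in> carrier L; U \<sqsubseteq> \<bottom>\<rbrakk> \<Longrightarrow> U = \<bottom>"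
  by (intro le_antisym) auto

lemma meet_mono:
  assumes "U \<in> carrier L" "V \<in> carrier L" "W \<in> carrier L" "U \<sqsubseteq> V"
  shows "U \<sqinter> W \<sqsubseteq> V \<sqinter> W"
proof (rule meet_le)
  show "U \<sqinter> W \<sqsubseteq> V" by (rule le_trans[OF meet_left assms(4)]) (use assms in simp_all)
  show "U \<sqinter> W \<sqsubseteq> W" by (rule meet_right) (use assms in simp_all)
qed (use assms in simp_all)

lemma meet_split:
  assumes "U \<in> carrier L" "V \<in> carrier L"
  shows "U = (U \<sqinter> V) \<squnion> (U \<sqinter> neg V)"
proof -
  have "U = U \<sqinter> \<top>" using assms by (intro le_antisym meet_le) (auto intro: meet_left)
  also have "\<dots> = U \<sqinter> (V \<squnion> neg V)" using assms by (simp add: join_neg)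
  finally show ?thesis using assms by (simp add: meet_join_distrib)
qed

text \<open>
  With \<open>le_neg_if_meet_bottom\<close> this turns inequalities into vanishing meets, the form in which
  filters and the measure can decide them.
\<close>
lemma le_if_meet_neg_bottom:
  assumes U: "U \<in> carrier L" and V: "V \<in> carrier L" and "U \<sqinter> neg V = \<bottom>"
  shows "U \<sqsubseteq> V"
proof -
  have "U = (U \<sqinter> V) \<squnion> \<bottom>" using meet_split[OF U V] assms(3) by simp
  also have "\<dots> \<sqsubseteq> V" using U V by (intro join_le) (auto intro: meet_right)
  finally show ?thesis .
qed

lemma le_neg_if_meet_bottom:
  assumes U: "U \<in> carrier L" and V: "V \<in> carrier L" and "U \<sqinter> V = \<bottom>"
  shows "U \<sqsubseteq> neg V"
proof -
  have "U = \<bottom> \<squnion> (U \<sqinter> neg V)" using meet_split[OF U V] assms(3) by simp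
  also have "\<dots> \<sqsubseteq> neg V" using U V by (intro join_le) (auto intro: meet_right)
  finally show ?thesis .
qed

section \<open>Filters and ultrafilters\<close>

definition proper_filter :: "'a set \<Rightarrow> bool" where
  "proper_filter F \<longleftrightarrow> F \<subseteq> carrier L \<and> \<top> \<in> F \<and> \<bottom> \<notin> F \<and>
     (\<forall>U\<in>F. \<forall>V\<in>F. U \<sqinter> V \<in> F) \<and> (\<forall>U\<in>F. \<forall>V\<in>carrier L. U \<sqsubseteq> V \<longrightarrow> V \<in> F)"

definition ultrafilter :: "'a set \<Rightarrow> bool" where
  "ultrafilter F \<longleftrightarrow> proper_filter F \<and> (\<forall>U\<in>carrier L. U \<in> F \<or> neg U \<in> F)"

lemma chain_Union_proper_filter:
  assumes "C \<noteq> {}" and "\<And>F. F \<in> C \<Longrightarrow> proper_filter F"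
    and chain: "\<And>F G. \<lbrakk>F \<in> C; G \<in> C\<rbrakk> \<Longrightarrow> F \<subseteq> G \<or> G \<subseteq> F"
  shows "proper_filter (\<Union>C)"
  unfolding proper_filter_def
proof (intro conjI ballI impI)
  fix U V assume "U \<in> \<Union>C" "V \<in> \<Union>C"
  then obtain F G where "F \<in> C" "U \<in> F" "G \<in> C" "V \<in> G" by blast
  then obtain F where "F \<in> C" "U \<in> F" "V \<in> F" using chain by blast
  then show "U \<sqinter> V \<in> \<Union>C" using assms(2) unfolding proper_filter_def by blast
next
  fix U V assume "U \<in> \<Union>C" "V \<in> carrier L" "U \<sqsubseteq> V"
  then show "V \<in> \<Union>C" using assms(2) unfolding proper_filter_def by blast
next
  show "\<Union>C \<subseteq> carrier L" "\<top> \<in> \<Union>C" "\<bottom> \<notin> \<Union>C"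
    using assms(1,2) unfolding proper_filter_def by blast+
qed

text \<open>The filter generated by \<open>F\<close> and \<open>U\<close>; it stays proper exactly because \<open>U\<close> meets every member of \<open>F\<close>.\<close>
lemma extend_proper_filter:
  assumes F: "proper_filter F" and U: "U \<in> carrier L" and meets: "\<And>V. V \<in> F \<Longrightarrow> V \<sqinter> U \<noteq> \<bottom>"
  shows "proper_filter {W \<in> carrier L. \<exists>V\<in>F. V \<sqinter> U \<sqsubseteq> W}" (is "proper_filter ?G")
  unfolding proper_filter_def
proof (intro conjI ballI impI)
  have FL: "F \<subseteq> carrier L" using F by (simp add: proper_filter_def)
  have "\<top> \<in> F" using F by (simp add: proper_filter_def)
  then show "\<top> \<in> ?G" using U by (auto intro!: bexI[of _ "\<top>"])
  show "?G \<subseteq> carrier L" by blast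
  show "\<bottom> \<notin> ?G"
  proof
    assume "\<bottom> \<in> ?G"
    then obtain V where V: "V \<in> F" "V \<sqinter> U \<sqsubseteq> \<bottom>" by auto
    then have "V \<sqinter> U = \<bottom>" using FL U by (intro le_bottomD) auto
    then show False using meets V(1) by simp
  qed
  fix W assume W: "W \<in> ?G"
  then obtain V where V: "V \<in> F" "V \<sqinter> U \<sqsubseteq> W" by auto
  { fix W' assume W': "W' \<in> ?G"
    then obtain V' where V': "V' \<in> F" "V' \<sqinter> U \<sqsubseteq> W'" by auto
    have c: "V \<in> carrier L" "V' \<in> carrier L" "W \<in> carrier L" "W' \<in> carrier L"
      using V V' W W' FL by auto
    have "(V \<sqinter> V') \<sqinter> U \<sqsubseteq> V \<sqinter> U" "(V \<sqinter> V') \<sqinter> U \<sqsubseteq> V' \<sqinter> U"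
      using c U by (simp_all add: meet_mono meet_left meet_right)
    then have "(V \<sqinter> V') \<sqinter> U \<sqsubseteq> W" "(V \<sqinter> V') \<sqinter> U \<sqsubseteq> W'"
      using le_trans[OF _ V(2)] le_trans[OF _ V'(2)] c U by simp_all
    then have "(V \<sqinter> V') \<sqinter> U \<sqsubseteq> W \<sqinter> W'"
      using c U by (simp add: meet_le)
    moreover have "V \<sqinter> V' \<in> F" using V V' F by (simp add: proper_filter_def)
    ultimately show "W \<sqinter> W' \<in> ?G" using c by auto }
  fix W' assume "W' \<in> carrier L" "W \<sqsubseteq> W'"
  moreover have "V \<sqinter> U \<sqsubseteq> W'" using calculation V W FL U le_trans[OF V(2), of W'] by auto
  ultimately show "W' \<in> ?G" using V by auto
qed

text \<open>
  A maximal proper filter \<open>M\<close> is an ultrafilter: if \<open>U \<notin> M\<close>, maximality prevents \<open>M\<close> from being extended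
  by \<open>U\<close>, so some \<open>V \<in> M\<close> is disjoint from \<open>U\<close>, that is, \<open>V \<sqsubseteq> neg U\<close>.
\<close>
lemma ultrafilter_exists:
  assumes "proper_filter F"
  obtains p where "ultrafilter p" "F \<subseteq> p"
proof -
  let ?\<A> = "{G. proper_filter G \<and> F \<subseteq> G}"
  have "\<exists>M\<in>?\<A>. \<forall>G\<in>?\<A>. M \<subseteq> G \<longrightarrow> G = M"
  proof (rule subset_Zorn_nonempty)
    fix C assume "C \<noteq> {}" "subset.chain ?\<A> C"
    then show "\<Union>C \<in> ?\<A>"
      using chain_Union_proper_filter[of C] unfolding subset_chain_def by blast
  qed (use assms in auto)
  then obtain M where M_max: "M \<in> ?\<A>" "\<forall>G\<in>?\<A>. M \<subseteq> G \<longrightarrow> G = M" ..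
  then have M: "proper_filter M" "F \<subseteq> M" by auto
  have max: "G = M" if "proper_filter G" "F \<subseteq> G" "M \<subseteq> G" for G
    using that by (intro M_max(2)[rule_format]) auto
  have M_carrier: "M \<subseteq> carrier L" using M by (simp add: proper_filter_def)
  have "neg U \<in> M" if U: "U \<in> carrier L" "U \<notin> M" for U
  proof -
    have top: "\<top> \<in> M" using M by (simp add: proper_filter_def)
    have "\<exists>V\<in>M. V \<sqinter> U = \<bottom>"
    proof (rule ccontr)
      let ?G = "{W \<in> carrier L. \<exists>V\<in>M. V \<sqinter> U \<sqsubseteq> W}"
      assume "\<not> (\<exists>V\<in>M. V \<sqinter> U = \<bottom>)"
      then have G: "proper_filter ?G" using M(1) U(1) by (intro extend_proper_filter) auto
      have MG: "M \<subseteq> ?G"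
      proof
        fix V assume "V \<in> M"
        then show "V \<in> ?G" using M_carrier U(1) by (auto intro!: bexI[of _ V] meet_left)
      qed
      have "\<top> \<sqinter> U \<sqsubseteq> U" using U(1) by (simp add: meet_right)
      then have "U \<in> ?G" using U(1) top by blast
      then show False using max[OF G _ MG] M(2) MG U(2) by blast
    qed
    then obtain V where V: "V \<in> M" "V \<sqinter> U = \<bottom>" by blast
    then have "V \<sqsubseteq> neg U" using M_carrier U(1) by (intro le_neg_if_meet_bottom) auto
    then show ?thesis using M(1) V(1) U(1) by (simp add: proper_filter_def)
  qed
  then have "ultrafilter M" using M(1) unfolding ultrafilter_def by blast
  then show thesis using that M(2) by blast
qed

end

section \<open>Boolean frames with a locally finite faithful measure\<close>

locale measured_boolean_frame = boolean_frame L for L (structure) +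
  fixes \<nu> :: "'a \<Rightarrow> ennreal"
  assumes measure: "locale_measure L \<nu>"
    and locally_finite: "locally_finite_measure L \<nu>"
    and faithful: "faithful_measure L \<nu>"
begin

lemma \<nu>_mono: "\<lbrakk>U \<in> carrier L; V \<in> carrier L; U \<sqsubseteq> V\<rbrakk> \<Longrightarrow> \<nu> U \<le> \<nu> V"
  using measure by (simp add: locale_measure_def)

lemma \<nu>_bottom: "\<nu> \<bottom> = 0"
  using measure by (simp add: locale_measure_def)

lemma \<nu>_modular: "\<lbrakk>U \<in> carrier L; V \<in> carrier L\<rbrakk> \<Longrightarrow> \<nu> U + \<nu> V = \<nu> (U \<squnion> V) + \<nu> (U \<sqinter> V)"
  using measure unfolding locale_measure_def by blast

lemma \<nu>_directed_Sup: "directed_in L A \<Longrightarrow> \<nu> (\<Squnion>A) = (SUP U\<in>A. \<nu> U)"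
  using measure unfolding locale_measure_def by blast

definition finite_elt :: "'a \<Rightarrow> bool" where
  "finite_elt U \<longleftrightarrow> U \<in> carrier L \<and> \<nu> U < \<infinity>"

lemma finite_elt_carrier: "finite_elt U \<Longrightarrow> U \<in> carrier L"
  by (simp add: finite_elt_def)

lemma finite_elt_mono: "\<lbrakk>finite_elt V; U \<in> carrier L; U \<sqsubseteq> V\<rbrakk> \<Longrightarrow> finite_elt U"
  using le_less_trans[OF \<nu>_mono[of U V]] by (simp add: finite_elt_def)

lemma finite_elt_join:
  assumes "finite_elt U" "finite_elt V"
  shows "finite_elt (U \<squnion> V)"
proof -
  have c: "U \<in> carrier L" "V \<in> carrier L" using assms by (simp_all add: finite_elt_def)
  have "\<nu> (U \<squnion> V) \<le> \<nu> U + \<nu> V" using \<nu>_modular[OF c] by simp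
  also have "\<dots> < \<infinity>" using assms by (simp add: finite_elt_def)
  finally show ?thesis using c by (simp add: finite_elt_def)
qed

lemma finite_elt_bottom: "finite_elt \<bottom>"
  by (simp add: finite_elt_def \<nu>_bottom)

text \<open>
  By frame distributivity \<open>U\<close> is the supremum of its meets with the elements of finite measure that cover
  \<open>\<top>\<close>, so these meets cannot all vanish.
\<close>
lemma finite_elt_below:
  assumes U: "U \<in> carrier L" "U \<noteq> \<bottom>"
  obtains A where "finite_elt A" "U \<sqinter> A \<noteq> \<bottom>"
proof -
  obtain S where "S \<subseteq> carrier L \<and> (\<forall>A\<in>S. \<nu> A < \<infinity>) \<and> \<Squnion>S = \<top>"
    using locally_finite unfolding locally_finite_measure_def ..
  then have S: "S \<subseteq> carrier L" "\<And>A. A \<in> S \<Longrightarrow> \<nu> A < \<infinity>" "\<Squnion>S = \<top>" by simp_all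
  have "\<exists>A\<in>S. U \<sqinter> A \<noteq> \<bottom>"
  proof (rule ccontr)
    assume "\<not> (\<exists>A\<in>S. U \<sqinter> A \<noteq> \<bottom>)"
    then have sub: "(\<lambda>A. U \<sqinter> A) ` S \<subseteq> {\<bottom>}" by auto
    have meets_closed: "(\<lambda>A. U \<sqinter> A) ` S \<subseteq> carrier L" using U(1) S(1) by auto
    have "U \<sqsubseteq> U \<sqinter> \<top>" using U(1) by (intro meet_le) simp_all
    also have "U \<sqinter> \<top> = \<Squnion>((\<lambda>A. U \<sqinter> A) ` S)" using meet_Sup_distrib[OF U(1) S(1)] S(3) by simp
    also have "\<dots> \<sqsubseteq> \<bottom>"
    proof (rule sup_least)
      fix y assume "y \<in> (\<lambda>A. U \<sqinter> A) ` S"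
      then have "y = \<bottom>" using sub by blast
      then show "y \<sqsubseteq> \<bottom>" by simp
    qed (use U(1) S(1) in auto)
    finally have "U \<sqsubseteq> \<bottom>" using U(1) meets_closed by simp
    then show False using U le_bottomD by simp
  qed
  then obtain A where "A \<in> S" "U \<sqinter> A \<noteq> \<bottom>" ..
  then show thesis using that[of A] S(1,2) by (auto simp: finite_elt_def)
qed

section \<open>Points and basic clopen sets\<close>

text \<open>
  The Stone space of all ultrafilters is compact, so a real-valued content on it would be bounded, however
  large the measure. Requiring an element of finite measure keeps the open subspace in which every point has
  a compact neighbourhood of finite measure.
\<close>
definition points :: "'a set set" where
  "points = {p. ultrafilter p \<and> (\<exists>A\<in>p. \<nu> A < \<infinity>)}"

definition clopen :: "'a \<Rightarrow> 'a set set" where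
  "clopen U = {p \<in> points. U \<in> p}"

lemma point_filter:
  assumes "p \<in> points"
  shows "p \<subseteq> carrier L" "\<top> \<in> p" "\<bottom> \<notin> p" "\<And>U V. \<lbrakk>U \<in> p; V \<in> p\<rbrakk> \<Longrightarrow> U \<sqinter> V \<in> p"
    "\<And>U V. \<lbrakk>U \<in> p; V \<in> carrier L; U \<sqsubseteq> V\<rbrakk> \<Longrightarrow> V \<in> p" "\<And>U. U \<in> carrier L \<Longrightarrow> U \<in> p \<or> neg U \<in> p"
  using assms by (simp_all add: points_def ultrafilter_def proper_filter_def)

lemma clopen_subset_points: "clopen U \<subseteq> points"
  by (auto simp: clopen_def)

lemma clopen_mono: "\<lbrakk>V \<in> carrier L; U \<sqsubseteq> V\<rbrakk> \<Longrightarrow> clopen U \<subseteq> clopen V"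
  using point_filter(5) by (auto simp: clopen_def)

lemma clopen_bottom: "clopen \<bottom> = {}"
  using point_filter(3) by (auto simp: clopen_def)

lemma clopen_meet:
  assumes "U \<in> carrier L" "V \<in> carrier L"
  shows "clopen (U \<sqinter> V) = clopen U \<inter> clopen V"
proof
  show "clopen (U \<sqinter> V) \<subseteq> clopen U \<inter> clopen V"
    using clopen_mono[of U "U \<sqinter> V"] clopen_mono[of V "U \<sqinter> V"] assms by (simp add: meet_left meet_right)
  show "clopen U \<inter> clopen V \<subseteq> clopen (U \<sqinter> V)"
    using point_filter(4) by (auto simp: clopen_def)
qed

lemma clopen_neg:
  assumes "U \<in> carrier L"
  shows "clopen (neg U) = points - clopen U"
proof -
  have "clopen U \<inter> clopen (neg U) = {}"
    using clopen_meet[of U "neg U"] assms by (simp add: meet_neg clopen_bottom)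
  moreover have "points \<subseteq> clopen U \<union> clopen (neg U)"
    using point_filter(6) assms by (auto simp: clopen_def)
  ultimately show ?thesis using clopen_subset_points by blast
qed

lemma point_exists:
  assumes F: "proper_filter F" and A: "finite_elt A" "A \<in> F"
  obtains p where "p \<in> clopen A" "F \<subseteq> p"
proof -
  obtain p where p: "ultrafilter p" "F \<subseteq> p" using ultrafilter_exists[OF F] by blast
  then have "p \<in> clopen A" using A unfolding clopen_def points_def finite_elt_def by blast
  then show thesis using that p(2) by blast
qed

text \<open>
  An ultrafilter containing \<open>U\<close> is a point only if it contains an element of finite measure, so the filter
  to extend is the one above \<open>U \<sqinter> A\<close> for a suitable \<open>A\<close> of finite measure.
\<close>
lemma clopen_nonempty:
  assumes U: "U \<in> carrier L" "U \<noteq> \<bottom>"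
  shows "clopen U \<noteq> {}"
proof -
  obtain A where A: "finite_elt A" "U \<sqinter> A \<noteq> \<bottom>" using finite_elt_below[OF U] .
  note Ac = finite_elt_carrier[OF A(1)]
  have "proper_filter {V \<in> carrier L. U \<sqinter> A \<sqsubseteq> V}" (is "proper_filter ?F")
    unfolding proper_filter_def
  proof (intro conjI ballI impI)
    show "\<bottom> \<notin> ?F" using A(2) le_bottomD[of "U \<sqinter> A"] U(1) Ac by auto
    fix V assume V: "V \<in> ?F"
    { fix W assume "W \<in> ?F"
      then show "V \<sqinter> W \<in> ?F" using V U(1) Ac by (simp add: meet_le) }
    fix W assume "W \<in> carrier L" "V \<sqsubseteq> W"
    then show "W \<in> ?F" using V U(1) Ac le_trans[of "U \<sqinter> A" V W] by simp
  qed (use U(1) Ac in auto)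
  moreover have "A \<in> ?F" "U \<in> ?F" using U(1) Ac by (simp_all add: meet_left meet_right)
  ultimately obtain p where "p \<in> clopen A" "?F \<subseteq> p" using point_exists A(1) by blast
  then have "p \<in> clopen U" using \<open>U \<in> ?F\<close> unfolding clopen_def by blast
  then show ?thesis by blast
qed

text \<open>
  The order of \<open>L\<close> can be read off from the clopen sets. Below, Boolean identities and inequalities
  in \<open>L\<close> are proved by passing to sets through this equivalence.
\<close>
lemma clopen_subset_iff:
  assumes "U \<in> carrier L" "V \<in> carrier L"
  shows "clopen U \<subseteq> clopen V \<longleftrightarrow> U \<sqsubseteq> V"
proof
  assume "clopen U \<subseteq> clopen V"
  then have "clopen (U \<sqinter> neg V) = {}" using assms by (simp add: clopen_meet clopen_neg) blast
  then have "U \<sqinter> neg V = \<bottom>" using clopen_nonempty[of "U \<sqinter> neg V"] assms by auto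
  then show "U \<sqsubseteq> V" using assms le_if_meet_neg_bottom by blast
qed (use assms clopen_mono in blast)

lemma clopen_join:
  assumes c: "U \<in> carrier L" "V \<in> carrier L"
  shows "clopen (U \<squnion> V) = clopen U \<union> clopen V"
proof
  show "clopen U \<union> clopen V \<subseteq> clopen (U \<squnion> V)"
    using c by (simp add: clopen_mono join_left join_right)
  have "U \<squnion> V \<sqsubseteq> neg (neg U \<sqinter> neg V)"
  proof (rule join_le)
    show "U \<sqsubseteq> neg (neg U \<sqinter> neg V)" "V \<sqsubseteq> neg (neg U \<sqinter> neg V)"
      using c clopen_subset_points
      by (auto simp: clopen_subset_iff[symmetric] clopen_neg clopen_meet)
  qed (use c in simp_all)
  then have "clopen (U \<squnion> V) \<subseteq> clopen (neg (neg U \<sqinter> neg V))" using c by (simp add: clopen_mono)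
  then show "clopen (U \<squnion> V) \<subseteq> clopen U \<union> clopen V"
    using c by (auto simp: clopen_neg clopen_meet)
qed

section \<open>The Stone topology\<close>

definition stone :: "'a set topology" where
  "stone = topology (\<lambda>S. S \<subseteq> points \<and> (\<forall>p\<in>S. \<exists>U\<in>p. clopen U \<subseteq> S))"

lemma openin_stone: "openin stone S \<longleftrightarrow> S \<subseteq> points \<and> (\<forall>p\<in>S. \<exists>U\<in>p. clopen U \<subseteq> S)"
proof -
  define is_open where "is_open S \<longleftrightarrow> S \<subseteq> points \<and> (\<forall>p\<in>S. \<exists>U\<in>p. clopen U \<subseteq> S)" for S
  have "is_open (S \<inter> T)" if S: "is_open S" and T: "is_open T" for S T
    unfolding is_open_def
  proof (intro conjI ballI)
    show "S \<inter> T \<subseteq> points" using S by (auto simp: is_open_def)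
    fix p assume p: "p \<in> S \<inter> T"
    then have pp: "p \<in> points" using S by (auto simp: is_open_def)
    obtain U where U: "U \<in> p" "clopen U \<subseteq> S" using S p unfolding is_open_def by auto
    obtain V where V: "V \<in> p" "clopen V \<subseteq> T" using T p unfolding is_open_def by auto
    have "U \<in> carrier L" "V \<in> carrier L" using point_filter(1)[OF pp] U V by auto
    then have "clopen (U \<sqinter> V) \<subseteq> S \<inter> T" using U V by (auto simp: clopen_meet)
    moreover have "U \<sqinter> V \<in> p" using point_filter(4)[OF pp] U V by simp
    ultimately show "\<exists>W\<in>p. clopen W \<subseteq> S \<inter> T" ..
  qed
  moreover have "is_open (\<Union>\<K>)" if \<K>: "\<forall>K\<in>\<K>. is_open K" for \<K>
    unfolding is_open_def
  proof (intro conjI ballI)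
    show "\<Union>\<K> \<subseteq> points" using \<K> by (auto simp: is_open_def)
    fix p assume "p \<in> \<Union>\<K>"
    then obtain K where K: "K \<in> \<K>" "p \<in> K" ..
    then have "\<exists>U\<in>p. clopen U \<subseteq> K" using \<K> by (simp add: is_open_def)
    then show "\<exists>U\<in>p. clopen U \<subseteq> \<Union>\<K>" using K(1) by blast
  qed
  ultimately have "istopology is_open" by (simp add: istopology_def)
  then show ?thesis by (simp add: stone_def topology_inverse' is_open_def[abs_def])
qed

lemma openin_clopen: "openin stone (clopen U)"
  by (auto simp: openin_stone clopen_def)

lemma topspace_stone: "topspace stone = points"
proof -
  have "openin stone points"
    using point_filter(2) clopen_subset_points by (auto simp: openin_stone)
  then show ?thesis unfolding topspace_def by (auto simp: openin_stone)
qed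

text \<open>
  If no finite part of a cover \<open>\<U>\<close> covered \<open>clopen A\<close>, the elements \<open>V\<close> for which \<open>clopen A - clopen V\<close> is
  finitely covered would form a proper filter. A point containing this filter lies in
  \<open>clopen A\<close> but in no member of \<open>\<U>\<close>. It is a point since it contains \<open>A\<close>, which has finite measure.
\<close>
lemma compactin_clopen:
  assumes A: "finite_elt A"
  shows "compactin stone (clopen A)"
  unfolding compactin_def
proof (intro conjI allI impI)
  show "clopen A \<subseteq> topspace stone" by (simp add: topspace_stone clopen_subset_points)
  fix \<U> assume \<U>: "(\<forall>U\<in>\<U>. openin stone U) \<and> clopen A \<subseteq> \<Union>\<U>"
  let ?covered = "\<lambda>S. \<exists>\<F>. finite \<F> \<and> \<F> \<subseteq> \<U> \<and> S \<subseteq> \<Union>\<F>"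
  have Ac: "A \<in> carrier L" using A by (rule finite_elt_carrier)
  show "?covered (clopen A)"
  proof (rule ccontr)
    assume not_covered: "\<not> ?covered (clopen A)"
    have "proper_filter {V \<in> carrier L. ?covered (clopen A - clopen V)}" (is "proper_filter ?F")
      unfolding proper_filter_def
    proof (intro conjI ballI impI)
      show "\<top> \<in> ?F"
        using clopen_mono[of \<top> A] Ac by (auto intro!: exI[of _ "{}"])
      show "\<bottom> \<notin> ?F" using not_covered by (simp add: clopen_bottom)
      fix V assume V: "V \<in> ?F"
      then obtain \<F> where \<F>: "finite \<F>" "\<F> \<subseteq> \<U>" "clopen A - clopen V \<subseteq> \<Union>\<F>" by blast
      { fix W assume W: "W \<in> ?F"
        then obtain \<G> where "finite \<G>" "\<G> \<subseteq> \<U>" "clopen A - clopen W \<subseteq> \<Union>\<G>" by blast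
        then have "?covered (clopen A - clopen (V \<sqinter> W))"
          using \<F> V W by (intro exI[of _ "\<F> \<union> \<G>"]) (auto simp: clopen_meet)
        then show "V \<sqinter> W \<in> ?F" using V W by simp }
      fix W assume W: "W \<in> carrier L" "V \<sqsubseteq> W"
      have "clopen V \<subseteq> clopen W" using W by (rule clopen_mono)
      then have "?covered (clopen A - clopen W)" using \<F> by (intro exI[of _ \<F>]) blast
      then show "W \<in> ?F" using W by simp
    qed blast
    moreover have "A \<in> ?F" using Ac by (auto intro!: exI[of _ "{}"])
    ultimately obtain p where p: "p \<in> clopen A" "?F \<subseteq> p" using point_exists A by blast
    then have pp: "p \<in> points" using clopen_subset_points by blast
    obtain G where G: "G \<in> \<U>" "p \<in> G" using \<U> p(1) by blast
    then obtain U where U: "U \<in> p" "clopen U \<subseteq> G" using \<U> unfolding openin_stone by blast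
    have Uc: "U \<in> carrier L" using U(1) point_filter(1)[OF pp] by blast
    then have "clopen A - clopen (neg U) \<subseteq> \<Union>{G}" using U(2) clopen_subset_points by (auto simp: clopen_neg)
    then have "?covered (clopen A - clopen (neg U))" using G(1) by (intro exI[of _ "{G}"]) simp
    then have "neg U \<in> p" using p(2) Uc by auto
    then have "p \<in> clopen U \<inter> clopen (neg U)" using U(1) pp by (simp add: clopen_def)
    then show False using Uc by (simp add: clopen_neg)
  qed
qed

lemma point_finite_elt:
  assumes p: "p \<in> points"
  obtains A where "finite_elt A" "p \<in> clopen A"
  using p point_filter(1)[OF p] that unfolding points_def clopen_def finite_elt_def by blast

lemma locally_compact_stone: "locally_compact_space stone"
  unfolding locally_compact_space_def topspace_stone
  by (metis compactin_clopen openin_clopen point_finite_elt subset_refl)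

lemma separating_clopen:
  assumes p: "p \<in> points" and q: "q \<in> points" and "p \<noteq> q"
  obtains U where "finite_elt U" "p \<in> clopen U" "q \<notin> clopen U"
proof -
  have "\<exists>U\<in>p. U \<notin> q"
  proof (rule ccontr)
    assume "\<not> ?thesis"
    then have "p \<subseteq> q" by blast
    moreover have "q \<subseteq> p"
    proof
      fix U assume U: "U \<in> q"
      then have Uc: "U \<in> carrier L" using point_filter(1)[OF q] by blast
      have "q \<in> clopen U" using U q by (simp add: clopen_def)
      then have "neg U \<notin> q" using clopen_neg[OF Uc] q by (auto simp: clopen_def)
      then show "U \<in> p" using \<open>p \<subseteq> q\<close> point_filter(6)[OF p Uc] by blast
    qed
    ultimately show False using \<open>p \<noteq> q\<close> by blast
  qed
  then obtain U where U: "U \<in> p" "U \<notin> q" by blast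
  have Uc: "U \<in> carrier L" using U(1) point_filter(1)[OF p] by blast
  obtain A where A: "finite_elt A" "p \<in> clopen A" using point_finite_elt[OF p] .
  have Ac: "A \<in> carrier L" using A(1) by (rule finite_elt_carrier)
  show thesis
  proof (rule that)
    show "finite_elt (U \<sqinter> A)" using A(1) Uc Ac finite_elt_mono meet_right by simp
    show "p \<in> clopen (U \<sqinter> A)" "q \<notin> clopen (U \<sqinter> A)"
      using U A(2) p Uc Ac by (simp_all add: clopen_meet) (auto simp: clopen_def)
  qed
qed

lemma Hausdorff_stone: "Hausdorff_space stone"
  unfolding Hausdorff_space_def topspace_stone
proof (intro allI impI)
  fix p q assume "p \<in> points \<and> q \<in> points \<and> p \<noteq> q"
  then obtain U where U: "finite_elt U" "p \<in> clopen U" "q \<notin> clopen U" and q: "q \<in> points"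
    using separating_clopen by metis
  then have "q \<in> clopen (neg U)" "disjnt (clopen U) (clopen (neg U))"
    using clopen_neg[of U] finite_elt_carrier[of U] by (auto simp: disjnt_def)
  then show "\<exists>U V. openin stone U \<and> openin stone V \<and> p \<in> U \<and> q \<in> V \<and> disjnt U V"
    using U(2) openin_clopen by blast
qed

text \<open>
  Compactness in the form used below: a family of elements that is closed under finite joins
  and whose clopen sets cover \<open>K\<close> contains a single element whose clopen set covers \<open>K\<close>.
\<close>
lemma compact_subset_clopen:
  assumes K: "compactin stone K"
    and P: "P \<subseteq> carrier L" "\<bottom> \<in> P" "\<And>U V. \<lbrakk>U \<in> P; V \<in> P\<rbrakk> \<Longrightarrow> U \<squnion> V \<in> P"
    and cover: "\<And>p. p \<in> K \<Longrightarrow> \<exists>U\<in>P. p \<in> clopen U"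
  obtains W where "W \<in> P" "K \<subseteq> clopen W"
proof -
  have "K \<subseteq> \<Union>(clopen ` P)" using cover by auto
  moreover have "\<forall>U\<in>clopen ` P. openin stone U" by (auto intro: openin_clopen)
  ultimately obtain \<F> where "finite \<F>" "\<F> \<subseteq> clopen ` P" "K \<subseteq> \<Union>\<F>"
    using K unfolding compactin_def by meson
  then obtain S where S: "finite S" "S \<subseteq> P" "K \<subseteq> \<Union>(clopen ` S)" by (metis finite_subset_image)
  have "\<exists>W\<in>P. \<Union>(clopen ` S) \<subseteq> clopen W" using S(1,2)
  proof (induction S)
    case empty
    then show ?case using P(2) by auto
  next
    case (insert U S)
    then obtain W where W: "W \<in> P" "\<Union>(clopen ` S) \<subseteq> clopen W" by auto
    then have "\<Union>(clopen ` insert U S) \<subseteq> clopen (U \<squnion> W)" 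
      using insert.prems P(1) by (auto simp: clopen_join subset_iff)
    then show ?case using P(3) W(1) insert.prems by blast
  qed
  then show thesis using that S(3) by blast
qed

section \<open>The core of a compact set\<close>

text \<open>
  For compact \<open>K\<close> this is the largest element \<open>U\<close> with \<open>clopen U \<subseteq> K\<close> (\<open>clopen_core_subset\<close>), so that
  \<open>clopen (core K)\<close> is the interior of \<open>K\<close>.
\<close>
definition core :: "'a set set \<Rightarrow> 'a" where
  "core K = \<Squnion>{U \<in> carrier L. clopen U \<subseteq> K}"

lemma core_closed [simp]: "core K \<in> carrier L"
  unfolding core_def by (rule sup_closed) blast

lemma le_core: "\<lbrakk>U \<in> carrier L; clopen U \<subseteq> K\<rbrakk> \<Longrightarrow> U \<sqsubseteq> core K"
  unfolding core_def by (rule sup_upper) blast+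

lemma core_least:
  assumes "\<And>U. \<lbrakk>U \<in> carrier L; clopen U \<subseteq> K\<rbrakk> \<Longrightarrow> U \<sqsubseteq> W" "W \<in> carrier L"
  shows "core K \<sqsubseteq> W"
  unfolding core_def by (rule sup_least) (use assms in auto)

lemma core_mono: "K \<subseteq> K' \<Longrightarrow> core K \<sqsubseteq> core K'"
  by (rule core_least) (auto intro!: le_core)

lemma core_le: "\<lbrakk>W \<in> carrier L; K \<subseteq> clopen W\<rbrakk> \<Longrightarrow> core K \<sqsubseteq> W"
  by (rule core_least) (auto simp: clopen_subset_iff[symmetric])

lemma core_clopen: "U \<in> carrier L \<Longrightarrow> core (clopen U) = U"
  by (intro le_antisym core_le le_core) simp_all

lemma core_empty: "core {} = \<bottom>"
  using core_clopen[of \<bottom>] by (simp add: clopen_bottom)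

lemma compact_subset_points: "compactin stone K \<Longrightarrow> K \<subseteq> points"
  using compactin_subset_topspace topspace_stone by blast

text \<open>
  A compact set is thus the intersection of the sets \<open>clopen W\<close> containing it. This is what
  makes the supremum of the clopen subsets of \<open>K\<close> and the infimum of its clopen supersets agree.
\<close>
lemma compact_separation:
  assumes K: "compactin stone K" and p: "p \<in> points" "p \<notin> K"
  obtains W where "finite_elt W" "K \<subseteq> clopen W" "p \<notin> clopen W"
proof -
  let ?P = "{U. finite_elt U \<and> p \<notin> clopen U}"
  have cover: "\<exists>U\<in>?P. q \<in> clopen U" if "q \<in> K" for q
  proof -
    have "q \<in> points" "q \<noteq> p" using that p compact_subset_points[OF K] by auto
    then obtain U where "finite_elt U" "q \<in> clopen U" "p \<notin> clopen U"
      using separating_clopen[of q p] p(1) by metis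
    then show ?thesis by auto
  qed
  have join: "U \<squnion> V \<in> ?P" if "U \<in> ?P" "V \<in> ?P" for U V
    using that by (simp add: finite_elt_join clopen_join finite_elt_carrier)
  obtain W where "W \<in> ?P" "K \<subseteq> clopen W"
    by (rule compact_subset_clopen[OF K _ _ join cover])
      (auto simp: finite_elt_carrier finite_elt_bottom clopen_bottom)
  then show thesis using that[of W] by simp
qed

text \<open>
  The set \<open>clopen\<close> of a supremum is in general larger than the union of the clopen sets. It still does
  not leave \<open>K\<close>, as every \<open>W\<close> with \<open>K \<subseteq> clopen W\<close> is an upper bound of the elements whose supremum is taken.
\<close>
lemma clopen_core_subset:
  assumes K: "compactin stone K"
  shows "clopen (core K) \<subseteq> K"
proof
  fix p assume p: "p \<in> clopen (core K)"
  show "p \<in> K"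
  proof (rule ccontr)
    assume "p \<notin> K"
    then obtain W where W: "finite_elt W" "K \<subseteq> clopen W" "p \<notin> clopen W"
      using compact_separation[OF K, of p] p clopen_subset_points by blast
    then have "core K \<sqsubseteq> W" by (intro core_le finite_elt_carrier)
    then have "clopen (core K) \<subseteq> clopen W" using W(1) by (intro clopen_mono finite_elt_carrier)
    then show False using p W(3) by blast
  qed
qed

lemma compact_subset_finite_clopen:
  assumes K: "compactin stone K"
  obtains W where "finite_elt W" "K \<subseteq> clopen W"
proof -
  have cover: "\<exists>U\<in>Collect finite_elt. q \<in> clopen U" if "q \<in> K" for q
  proof -
    have "q \<in> points" using that compact_subset_points[OF K] by auto
    then obtain U where "finite_elt U" "q \<in> clopen U" by (rule point_finite_elt)
    then show ?thesis by auto
  qed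
  have join: "U \<squnion> V \<in> Collect finite_elt" if "U \<in> Collect finite_elt" "V \<in> Collect finite_elt" for U V
    using that by (simp add: finite_elt_join)
  obtain W where "W \<in> Collect finite_elt" "K \<subseteq> clopen W"
    by (rule compact_subset_clopen[OF K _ _ join cover])
      (auto simp: finite_elt_carrier finite_elt_bottom)
  then show thesis using that[of W] by simp
qed

lemma finite_elt_core:
  assumes "compactin stone K"
  shows "finite_elt (core K)"
proof -
  obtain W where "finite_elt W" "K \<subseteq> clopen W" using compact_subset_finite_clopen[OF assms] .
  then show ?thesis
    using finite_elt_mono[of W "core K"] core_le[of W K] by (simp add: finite_elt_carrier)
qed

lemma core_Int:
  assumes "compactin stone K" "compactin stone K'"
  shows "core (K \<inter> K') = core K \<sqinter> core K'"
proof (rule le_antisym)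
  show "core (K \<inter> K') \<sqsubseteq> core K \<sqinter> core K'" by (intro meet_le core_mono) auto
  show "core K \<sqinter> core K' \<sqsubseteq> core (K \<inter> K')"
    using clopen_core_subset assms by (intro le_core) (auto simp: clopen_meet)
qed auto

text \<open>
  The point is that the interior of \<open>K \<union> K'\<close> adds nothing to the join of the interiors. The
  difference \<open>V\<close> satisfies \<open>clopen V \<subseteq> K \<union> K'\<close>; since \<open>K'\<close> is closed, \<open>clopen V - K'\<close> is an open subset of
  \<open>K\<close> and hence contained in \<open>clopen (core K)\<close>, which \<open>V\<close> avoids. So \<open>clopen V\<close> lies in \<open>K'\<close>, and then
  in \<open>clopen (core K')\<close>, which \<open>V\<close> avoids as well.
\<close>
lemma core_Un:
  assumes K: "compactin stone K" and K': "compactin stone K'"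
  shows "core (K \<union> K') = core K \<squnion> core K'"
proof (rule le_antisym)
  show "core K \<squnion> core K' \<sqsubseteq> core (K \<union> K')" by (intro join_le core_mono) auto
  define V where "V = core (K \<union> K') \<sqinter> neg (core K \<squnion> core K')"
  have V: "V \<in> carrier L" by (simp add: V_def)
  have clopen_V: "clopen V = clopen (core (K \<union> K')) - (clopen (core K) \<union> clopen (core K'))"
    using clopen_subset_points by (auto simp: V_def clopen_meet clopen_neg clopen_join)
  then have V_sub: "clopen V \<subseteq> K \<union> K'"
    using clopen_core_subset[OF compactin_Un[OF K K']] by blast
  have "clopen V \<subseteq> K'"
  proof (rule ccontr)
    assume "\<not> clopen V \<subseteq> K'"
    then obtain p where p: "p \<in> clopen V - K'" by blast
    have "openin stone (clopen V - K')"
      by (intro openin_diff openin_clopen compactin_imp_closedin Hausdorff_stone K')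
    then obtain U where U: "U \<in> p" "clopen U \<subseteq> clopen V - K'"
      using p unfolding openin_stone by blast
    have pp: "p \<in> points" using p clopen_subset_points by blast
    have Uc: "U \<in> carrier L" using point_filter(1)[OF pp] U(1) by blast
    have "clopen U \<subseteq> K" using U(2) V_sub by blast
    then have "clopen U \<subseteq> clopen (core K)" using Uc by (simp add: le_core clopen_mono)
    moreover have "p \<in> clopen U" using U(1) pp by (simp add: clopen_def)
    ultimately show False using p clopen_V by blast
  qed
  then have "clopen V \<subseteq> clopen (core K')" using V by (simp add: le_core clopen_mono)
  then have "clopen V = {}" using clopen_V by blast
  then have "V = \<bottom>" using clopen_nonempty V by blast
  then show "core (K \<union> K') \<sqsubseteq> core K \<squnion> core K'"
    by (intro le_if_meet_neg_bottom) (simp_all add: V_def)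
qed auto

lemma core_Union_le:
  assumes "finite F" "U \<in> carrier L" "\<And>K. K \<in> F \<Longrightarrow> compactin stone K \<and> core K \<sqsubseteq> U"
  shows "core (\<Union>F) \<sqsubseteq> U"
  using assms(1,3)
proof (induction F)
  case empty
  then show ?case using assms(2) by (simp add: core_empty)
next
  case (insert K F)
  have "compactin stone (\<Union>F)" by (rule compactin_Union) (use insert in auto)
  then show ?case using insert assms(2) by (auto simp: core_Un intro!: join_le)
qed

section \<open>The regular content\<close>

definition stone_content :: "'a set set \<Rightarrow> real" where
  "stone_content K = enn2real (\<nu> (core K))"

lemma stone_content_nonneg: "0 \<le> stone_content K"
  by (simp add: stone_content_def)

lemma ennreal_stone_content: "compactin stone K \<Longrightarrow> ennreal (stone_content K) = \<nu> (core K)"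
  using finite_elt_core[of K] by (simp add: stone_content_def finite_elt_def)

lemma \<nu>_split:
  assumes "U \<in> carrier L" "V \<in> carrier L"
  shows "\<nu> U = \<nu> (U \<sqinter> V) + \<nu> (U \<sqinter> neg V)"
proof -
  have "clopen ((U \<sqinter> V) \<sqinter> (U \<sqinter> neg V)) = {}" using assms by (auto simp: clopen_meet clopen_neg)
  then have "(U \<sqinter> V) \<sqinter> (U \<sqinter> neg V) = \<bottom>" using clopen_nonempty assms by (metis meet_closed neg_closed)
  then show ?thesis
    using \<nu>_modular[of "U \<sqinter> V" "U \<sqinter> neg V"] meet_split[of U V] assms by (simp add: \<nu>_bottom)
qed

text \<open>Since \<open>core\<close> is a lattice homomorphism, the content inherits modularity from the measure.\<close>
lemma content_on_stone: "content_on stone stone_content"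
proof -
  have mono: "stone_content C \<le> stone_content D"
    if "compactin stone C" "compactin stone D" "C \<subseteq> D" for C D
  proof -
    have "ennreal (stone_content C) \<le> ennreal (stone_content D)"
      using that by (simp add: ennreal_stone_content \<nu>_mono core_mono)
    then show ?thesis by (simp add: stone_content_nonneg)
  qed
  have modular: "ennreal (stone_content C + stone_content D) =
      ennreal (stone_content (C \<union> D)) + \<nu> (core (C \<inter> D))"
    if C: "compactin stone C" and D: "compactin stone D" for C D
    unfolding ennreal_plus[OF stone_content_nonneg stone_content_nonneg]
      ennreal_stone_content[OF C] ennreal_stone_content[OF D]
      ennreal_stone_content[OF compactin_Un[OF C D]] core_Un[OF C D] core_Int[OF C D]
    by (rule \<nu>_modular) simp_all
  have subadditive: "stone_content (C \<union> D) \<le> stone_content C + stone_content D"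
    if "compactin stone C" "compactin stone D" for C D
  proof -
    have "ennreal (stone_content (C \<union> D)) \<le> ennreal (stone_content C + stone_content D)"
      unfolding modular[OF that] by simp
    then show ?thesis by (simp add: stone_content_nonneg del: ennreal_plus)
  qed
  have additive: "stone_content (C \<union> D) = stone_content C + stone_content D"
    if "compactin stone C" "compactin stone D" "C \<inter> D = {}" for C D
  proof -
    have "ennreal (stone_content (C \<union> D)) = ennreal (stone_content C + stone_content D)"
      unfolding modular[OF that(1,2)] that(3) by (simp add: core_empty \<nu>_bottom)
    then show ?thesis by (simp add: stone_content_nonneg del: ennreal_plus)
  qed
  show ?thesis
    using mono subadditive additive by (simp add: content_on_def stone_content_nonneg)
qed

text \<open>
  Continuity from above. Inside a fixed \<open>W0\<close> of finite measure with \<open>K \<subseteq> clopen W0\<close>, the complements of the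
  clopen supersets of \<open>K\<close> form an upward directed family with supremum \<open>W0 \<sqinter> neg (core K)\<close>. The measure commutes with this
  supremum, and subtracting from the finite number \<open>\<nu> W0\<close> gives the claim.
\<close>
lemma INF_clopen_le_\<nu>_core:
  assumes K: "compactin stone K"
  shows "(INF W\<in>{W. finite_elt W \<and> K \<subseteq> clopen W}. \<nu> W) \<le> \<nu> (core K)"
proof -
  let ?\<W> = "{W. finite_elt W \<and> K \<subseteq> clopen W}"
  let ?I = "INF W\<in>?\<W>. \<nu> W"
  obtain W0 where W0: "finite_elt W0" "K \<subseteq> clopen W0" using compact_subset_finite_clopen[OF K] .
  have W0c: "W0 \<in> carrier L" using W0(1) by (rule finite_elt_carrier)
  define D where "D = (\<lambda>W. W0 \<sqinter> neg W) ` ?\<W>"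
  have meet_\<W>: "W \<sqinter> W' \<in> ?\<W>" if "W \<in> ?\<W>" "W' \<in> ?\<W>" for W W'
    using that finite_elt_mono[of W "W \<sqinter> W'"] by (auto simp: finite_elt_carrier clopen_meet meet_left)
  have Dc: "D \<subseteq> carrier L" using W0c by (auto simp: D_def finite_elt_carrier)
  have antitone: "W0 \<sqinter> neg W \<sqsubseteq> W0 \<sqinter> neg W'"
    if "W \<in> carrier L" "W' \<in> carrier L" "clopen W' \<subseteq> clopen W" for W W'
    using that W0c by (auto simp: clopen_subset_iff[symmetric] clopen_meet clopen_neg)
  have directed: "directed_in L D"
    unfolding directed_in_def
  proof (intro conjI ballI)
    show "D \<noteq> {}" using W0 by (auto simp: D_def)
    fix A B assume "A \<in> D" "B \<in> D"
    then obtain W W' where W: "W \<in> ?\<W>" "A = W0 \<sqinter> neg W" "W' \<in> ?\<W>" "B = W0 \<sqinter> neg W'"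
      unfolding D_def by blast
    then have c: "W \<in> carrier L" "W' \<in> carrier L" by (simp_all add: finite_elt_carrier)
    have "A \<sqsubseteq> W0 \<sqinter> neg (W \<sqinter> W')" "B \<sqsubseteq> W0 \<sqinter> neg (W \<sqinter> W')"
      unfolding W using c by (auto intro!: antitone simp: clopen_meet)
    moreover have "W0 \<sqinter> neg (W \<sqinter> W') \<in> D" using meet_\<W>[OF W(1,3)] unfolding D_def by blast
    ultimately show "\<exists>C\<in>D. A \<sqsubseteq> C \<and> B \<sqsubseteq> C" by blast
  qed (fact Dc)
  have "W0 \<sqinter> neg (core K) \<sqsubseteq> \<Squnion>D" if "W0 \<sqinter> neg (\<Squnion>D) \<sqsubseteq> core K"
    using that W0c Dc by (auto simp: clopen_subset_iff[symmetric] clopen_meet clopen_neg)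
  moreover have "W0 \<sqinter> neg (\<Squnion>D) \<sqsubseteq> core K"
  proof (rule le_core)
    show "clopen (W0 \<sqinter> neg (\<Squnion>D)) \<subseteq> K"
    proof
      fix p assume p: "p \<in> clopen (W0 \<sqinter> neg (\<Squnion>D))"
      then have pp: "p \<in> points" "p \<in> clopen W0" "p \<notin> clopen (\<Squnion>D)"
        using W0c Dc clopen_subset_points by (auto simp: clopen_meet clopen_neg)
      have in_all: "p \<in> clopen W" if "W \<in> ?\<W>" for W
      proof (rule ccontr)
        assume "p \<notin> clopen W"
        moreover have Wc: "W \<in> carrier L" using that by (simp add: finite_elt_carrier)
        ultimately have "p \<in> clopen (W0 \<sqinter> neg W)" using pp W0c by (simp add: clopen_meet clopen_neg)
        moreover have "W0 \<sqinter> neg W \<sqsubseteq> \<Squnion>D" using Dc that by (intro sup_upper) (auto simp: D_def)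
        ultimately show False using clopen_mono[of "\<Squnion>D"] Dc pp(3) by auto
      qed
      show "p \<in> K" using compact_separation[OF K pp(1)] in_all by auto
    qed
  qed (use W0c Dc in simp)
  ultimately have "W0 \<sqinter> neg (core K) \<sqsubseteq> \<Squnion>D" by blast
  then have "\<nu> (W0 \<sqinter> neg (core K)) \<le> (SUP A\<in>D. \<nu> A)"
    using \<nu>_mono[of "W0 \<sqinter> neg (core K)" "\<Squnion>D"] W0c Dc by (simp add: \<nu>_directed_Sup[OF directed])
  then have "?I + \<nu> (W0 \<sqinter> neg (core K)) \<le> ?I + (SUP A\<in>D. \<nu> A)"
    by (rule add_left_mono)
  also have "\<dots> = (SUP A\<in>D. ?I + \<nu> A)"
    using directed by (intro ennreal_SUP_add_right) (simp add: directed_in_def)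
  also have "\<dots> \<le> \<nu> W0"
  proof (rule SUP_least)
    fix A assume "A \<in> D"
    then obtain W where W: "W \<in> ?\<W>" "A = W0 \<sqinter> neg W" unfolding D_def by blast
    have "W0 \<sqinter> W \<in> ?\<W>" using W W0 by (intro meet_\<W>) simp_all
    then have "?I \<le> \<nu> (W0 \<sqinter> W)" by (rule INF_lower)
    then show "?I + \<nu> A \<le> \<nu> W0"
      using W \<nu>_split[of W0 W] W0c by (simp add: finite_elt_carrier add_right_mono)
  qed
  also have "\<nu> W0 = \<nu> (core K) + \<nu> (W0 \<sqinter> neg (core K))"
  proof -
    have "core K \<sqsubseteq> W0" using W0 W0c by (intro core_le)
    then have "W0 \<sqinter> core K = core K"
      using W0c by (intro le_antisym meet_le meet_right) simp_all
    then show ?thesis using \<nu>_split[of W0 "core K"] W0c by simp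
  qed
  finally have "\<nu> (W0 \<sqinter> neg (core K)) + ?I \<le> \<nu> (W0 \<sqinter> neg (core K)) + \<nu> (core K)"
    by (simp add: add.commute)
  \<comment> \<open>The common summand can be cancelled because it is finite.\<close>
  moreover have "finite_elt (W0 \<sqinter> neg (core K))"
    using W0 W0c by (intro finite_elt_mono[OF W0(1)]) (simp_all add: meet_left)
  then have "\<nu> (W0 \<sqinter> neg (core K)) \<noteq> \<infinity>" by (auto simp: finite_elt_def)
  ultimately show ?thesis by (simp add: ennreal_add_left_cancel_le)
qed

text \<open>
  The sets \<open>clopen W\<close> are at once open and compact, so each of them that contains \<open>K\<close> is
  a compact neighbourhood of \<open>K\<close>, and regularity follows from continuity of the measure from above.
\<close>
lemma regular_content_stone: "regular_content stone stone_content"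
  unfolding regular_content_def
proof (intro conjI allI impI content_on_stone antisym)
  fix K assume K: "compactin stone K"
  let ?\<D> = "{D. compactin stone D \<and> way_inside stone K D}"
  show "ennreal (stone_content K) \<le> (INF D\<in>?\<D>. ennreal (stone_content D))"
  proof (rule INF_greatest)
    fix D assume "D \<in> ?\<D>"
    then have "compactin stone D" "K \<subseteq> D" unfolding way_inside_def by auto
    then show "ennreal (stone_content K) \<le> ennreal (stone_content D)"
      using content_on_stone K unfolding content_on_def by (simp add: ennreal_leI)
  qed
  have "(INF D\<in>?\<D>. ennreal (stone_content D)) \<le> (INF W\<in>{W. finite_elt W \<and> K \<subseteq> clopen W}. \<nu> W)"
  proof (rule INF_mono)
    fix W assume "W \<in> {W. finite_elt W \<and> K \<subseteq> clopen W}"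
    then have W: "finite_elt W" "K \<subseteq> clopen W" by simp_all
    have "clopen W \<in> ?\<D>"
      using W by (auto simp: way_inside_def compactin_clopen intro!: exI[of _ "clopen W"] openin_clopen)
    moreover have "ennreal (stone_content (clopen W)) = \<nu> W"
      using W(1) by (simp add: ennreal_stone_content compactin_clopen core_clopen finite_elt_carrier)
    ultimately show "\<exists>D\<in>?\<D>. ennreal (stone_content D) \<le> \<nu> W"
      by (intro bexI[of _ "clopen W"]) simp_all
  qed
  also have "\<dots> \<le> ennreal (stone_content K)"
    using INF_clopen_le_\<nu>_core[OF K] K by (simp add: ennreal_stone_content)
  finally show "(INF D\<in>?\<D>. ennreal (stone_content D)) \<le> ennreal (stone_content K)" .
qed

section \<open>Content ideals and elements of the frame\<close>

text \<open>Faithfulness compares two elements on all pieces of finite measure; here they are \<open>\<bottom>\<close> and \<open>U\<close>.\<close>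
lemma null_imp_bottom:
  assumes U: "U \<in> carrier L" "\<nu> U = 0"
  shows "U = \<bottom>"
proof -
  have "\<nu> (\<bottom> \<sqinter> K) = \<nu> (U \<sqinter> K)" if K: "K \<in> carrier L" for K
  proof -
    have "\<nu> (\<bottom> \<sqinter> K) \<le> 0" using \<nu>_mono[of "\<bottom> \<sqinter> K" \<bottom>] K by (simp add: meet_left \<nu>_bottom)
    moreover have "\<nu> (U \<sqinter> K) \<le> 0" using \<nu>_mono[of "U \<sqinter> K" U] K U by (simp add: meet_left)
    ultimately show ?thesis by simp
  qed
  moreover have "\<bottom> \<sqsubseteq> U" using U by simp
  ultimately have "\<bottom> = U"
    using faithful[unfolded faithful_measure_def, rule_format, of \<bottom> U] U(1) by blast
  then show ?thesis by simp
qed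

definition ideal_of :: "'a \<Rightarrow> 'a set set set" where
  "ideal_of U = {K. compactin stone K \<and> core K \<sqsubseteq> U}"

text \<open>
  Only the approximation condition needs an argument. Finite unions of members of \<open>S\<close> have their core below
  \<open>core K \<sqinter> U\<close>, so if their contents approach that of \<open>K\<close>, the remainder \<open>core K \<sqinter> neg U\<close>
  is a null element and therefore \<open>\<bottom>\<close>.
\<close>
lemma content_ideal_ideal_of:
  assumes U: "U \<in> carrier L"
  shows "content_ideal stone stone_content (ideal_of U)"
  unfolding content_ideal_def
proof (intro conjI allI impI ballI)
  show "ideal_of U \<subseteq> {K. compactin stone K}" by (auto simp: ideal_of_def)
next
  fix K C assume "K \<in> ideal_of U" "compactin stone C \<and> C \<subseteq> K"
  then show "C \<in> ideal_of U"
    using core_mono[of C K] le_trans[of "core C" "core K" U] U by (simp add: ideal_of_def)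
next
  fix K S
  assume "compactin stone K \<and> S \<subseteq> ideal_of U \<and> (\<forall>C\<in>S. C \<subseteq> K) \<and>
      (\<forall>\<epsilon>>0. \<exists>F. finite F \<and> F \<subseteq> S \<and> stone_content K - stone_content (\<Union>F) < \<epsilon>)"
  then have K: "compactin stone K" and S: "S \<subseteq> ideal_of U" "\<And>C. C \<in> S \<Longrightarrow> C \<subseteq> K"
    and approx: "\<And>\<epsilon>. 0 < \<epsilon> \<Longrightarrow> \<exists>F. finite F \<and> F \<subseteq> S \<and> stone_content K - stone_content (\<Union>F) < \<epsilon>"
    by auto
  define A B where "A = core K \<sqinter> U" and "B = core K \<sqinter> neg U"
  have AB: "A \<in> carrier L" "B \<in> carrier L" using U by (simp_all add: A_def B_def)
  have fin: "finite_elt A" "finite_elt B"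
    using U by (auto simp: A_def B_def intro!: finite_elt_mono[OF finite_elt_core[OF K]] meet_left)
  have "\<nu> (core K) = \<nu> A + \<nu> B" unfolding A_def B_def using U by (intro \<nu>_split) simp_all
  then have split: "stone_content K = enn2real (\<nu> A) + enn2real (\<nu> B)"
    using fin by (simp add: stone_content_def finite_elt_def enn2real_plus)
  have "enn2real (\<nu> B) \<le> \<epsilon>" if \<epsilon>: "0 < \<epsilon>" for \<epsilon>
  proof -
    obtain F where F: "finite F" "F \<subseteq> S" "stone_content K - stone_content (\<Union>F) < \<epsilon>"
      using approx[OF \<epsilon>] by blast
    have F_ideal: "compactin stone C \<and> core C \<sqsubseteq> U" if "C \<in> F" for C
      using that F(2) S(1) by (auto simp: ideal_of_def)
    have "core (\<Union>F) \<sqsubseteq> A"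
      unfolding A_def
    proof (intro meet_le)
      show "core (\<Union>F) \<sqsubseteq> core K" using F(2) S(2) by (intro core_mono) blast
      show "core (\<Union>F) \<sqsubseteq> U" by (rule core_Union_le[OF F(1) U F_ideal])
    qed (use U in simp_all)
    then have "stone_content (\<Union>F) \<le> enn2real (\<nu> A)"
      unfolding stone_content_def using AB fin(1) by (intro enn2real_mono \<nu>_mono) (simp_all add: finite_elt_def)
    then show ?thesis using F(3) split by simp
  qed
  then have "enn2real (\<nu> B) \<le> 0" by (rule field_le_epsilon[of _ 0, simplified])
  then have "enn2real (\<nu> B) = 0" using enn2real_nonneg[of "\<nu> B"] by linarith
  then have "\<nu> B = 0" using fin(2) by (auto simp: finite_elt_def enn2real_eq_0_iff)
  then have "B = \<bottom>" using AB null_imp_bottom by blast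
  then have "core K \<sqsubseteq> U" using U unfolding B_def by (intro le_if_meet_neg_bottom) simp_all
  then show "K \<in> ideal_of U" using K by (simp add: ideal_of_def)
qed

text \<open>
  The elements of finite measure below \<open>U\<close> are the cores of their own compact clopen sets, and by local
  finiteness they exhaust \<open>U\<close>.
\<close>
lemma Sup_core_ideal_of:
  assumes U: "U \<in> carrier L"
  shows "\<Squnion>(core ` ideal_of U) = U"
proof (rule le_antisym)
  let ?T = "\<Squnion>(core ` ideal_of U)"
  have sub: "core ` ideal_of U \<subseteq> carrier L" by auto
  show "?T \<sqsubseteq> U" by (rule sup_least) (use U sub in \<open>auto simp: ideal_of_def\<close>)
  have "U \<sqinter> neg ?T = \<bottom>"
  proof (rule ccontr)
    assume ne: "U \<sqinter> neg ?T \<noteq> \<bottom>"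
    have c: "U \<sqinter> neg ?T \<in> carrier L" "neg ?T \<in> carrier L" using U sub by simp_all
    obtain A where A: "finite_elt A" "(U \<sqinter> neg ?T) \<sqinter> A \<noteq> \<bottom>" using finite_elt_below[OF c(1) ne] .
    define W where "W = (U \<sqinter> neg ?T) \<sqinter> A"
    have Ac: "A \<in> carrier L" and Wc: "W \<in> carrier L"
      using A(1) c by (simp_all add: W_def finite_elt_carrier)
    have W: "finite_elt W" using A(1) Wc c Ac by (auto simp: W_def intro: finite_elt_mono meet_right)
    have clopen_W: "clopen W = clopen U \<inter> clopen (neg ?T) \<inter> clopen A"
      using U c Ac by (simp add: W_def clopen_meet)
    then have "W \<sqsubseteq> U" using U Wc by (auto simp: clopen_subset_iff[symmetric])
    then have "clopen W \<in> ideal_of U" using W Wc by (simp add: ideal_of_def compactin_clopen core_clopen)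
    then have "core (clopen W) \<sqsubseteq> ?T" using sub by (intro sup_upper) auto
    then have "clopen W \<subseteq> clopen ?T" using Wc sub by (simp add: core_clopen clopen_mono)
    then have "clopen W = {}" using clopen_W clopen_neg[of ?T] sub by auto
    then show False using clopen_nonempty[OF Wc] A(2) by (simp add: W_def)
  qed
  then show "U \<sqsubseteq> ?T" using U sub by (intro le_if_meet_neg_bottom) simp_all
qed (use U in \<open>auto intro!: sup_closed\<close>)

text \<open>
  If \<open>core K\<close> is below the supremum of the cores of \<open>J\<close>, distributivity and \<open>core_Int\<close> show that it is already
  the supremum of the cores of the members of \<open>J\<close> inside \<open>K\<close>. These form a directed family,
  so continuity of the measure makes single members of it approximate the content of \<open>K\<close>, and the
  closure condition puts \<open>K\<close> into \<open>J\<close>.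
\<close>
lemma ideal_of_Sup_core:
  assumes J: "content_ideal stone stone_content J"
  shows "ideal_of (\<Squnion>(core ` J)) = J"
proof
  have J_compact: "compactin stone K" if "K \<in> J" for K using J that by (auto simp: content_ideal_def)
  have J_down: "C \<in> J" if "K \<in> J" "compactin stone C" "C \<subseteq> K" for K C
    using J that unfolding content_ideal_def by blast
  have J_closed: "K \<in> J" if "compactin stone K" "S \<subseteq> J" "\<And>C. C \<in> S \<Longrightarrow> C \<subseteq> K"
    "\<And>\<epsilon>. 0 < \<epsilon> \<Longrightarrow> \<exists>F. finite F \<and> F \<subseteq> S \<and> stone_content K - stone_content (\<Union>F) < \<epsilon>" for K S
  proof -
    have "\<forall>K S. compactin stone K \<and> S \<subseteq> J \<and> (\<forall>C\<in>S. C \<subseteq> K) \<and>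
        (\<forall>\<epsilon>>0. \<exists>F. finite F \<and> F \<subseteq> S \<and> stone_content K - stone_content (\<Union>F) < \<epsilon>) \<longrightarrow> K \<in> J"
      using J unfolding content_ideal_def by (elim conjE)
    then show ?thesis by (elim allE[of _ K] allE[of _ S] mp) (intro conjI ballI allI impI that)
  qed
  \<comment> \<open>The closure condition for an empty family; it makes the directed family below nonempty.\<close>
  have J_empty: "{} \<in> J" by (rule J_closed[of _ "{}"]) (auto intro!: exI[of _ "{}"])
  have J_Un: "K \<union> K' \<in> J" if "K \<in> J" "K' \<in> J" for K K'
    by (rule J_closed[of _ "{K, K'}"])
      (use that J_compact in \<open>auto intro!: exI[of _ "{K, K'}"] compactin_Un\<close>)
  have sub: "core ` J \<subseteq> carrier L" by auto
  show "J \<subseteq> ideal_of (\<Squnion>(core ` J))"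
  proof
    fix K assume "K \<in> J"
    then show "K \<in> ideal_of (\<Squnion>(core ` J))" using J_compact sub by (auto simp: ideal_of_def intro!: sup_upper)
  qed
  show "ideal_of (\<Squnion>(core ` J)) \<subseteq> J"
  proof
    fix K assume "K \<in> ideal_of (\<Squnion>(core ` J))"
    then have K: "compactin stone K" and K_le: "core K \<sqsubseteq> \<Squnion>(core ` J)" by (simp_all add: ideal_of_def)
    let ?S = "{C \<in> J. C \<subseteq> K}"
    have subS: "core ` ?S \<subseteq> carrier L" and meets_closed: "(\<lambda>U. core K \<sqinter> U) ` core ` J \<subseteq> carrier L"
      by auto
    have "core K \<sqsubseteq> core K \<sqinter> \<Squnion>(core ` J)" using K_le sub by (intro meet_le) simp_all
    also have "\<dots> = \<Squnion>((\<lambda>U. core K \<sqinter> U) ` core ` J)" using sub by (intro meet_Sup_distrib) simp_all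
    also have "\<dots> \<sqsubseteq> \<Squnion>(core ` ?S)"
    proof (rule sup_least)
      fix y assume "y \<in> (\<lambda>U. core K \<sqinter> U) ` core ` J"
      then obtain C where C: "C \<in> J" "y = core K \<sqinter> core C" by blast
      have "compactin stone (K \<inter> C)"
        using K J_compact[OF C(1)] Hausdorff_stone by (intro compact_Int_closedin compactin_imp_closedin)
      then have "K \<inter> C \<in> ?S" using J_down[OF C(1)] by simp
      moreover have "y = core (K \<inter> C)" using C K J_compact by (simp add: core_Int)
      ultimately show "y \<sqsubseteq> \<Squnion>(core ` ?S)" using subS by (intro sup_upper) auto
    qed (use subS in auto)
    finally have core_le_Sup: "core K \<sqsubseteq> \<Squnion>(core ` ?S)" using subS meets_closed by simp
    have directed: "directed_in L (core ` ?S)"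
      unfolding directed_in_def
    proof (intro conjI ballI)
      show "core ` ?S \<noteq> {}" using J_empty by auto
      fix U V assume "U \<in> core ` ?S" "V \<in> core ` ?S"
      then obtain C D where CD: "C \<in> ?S" "U = core C" "D \<in> ?S" "V = core D" by blast
      then have "C \<union> D \<in> ?S" using J_Un by simp
      then show "\<exists>W\<in>core ` ?S. U \<sqsubseteq> W \<and> V \<sqsubseteq> W"
        using CD by (intro bexI[of _ "core (C \<union> D)"]) (auto intro!: core_mono)
    qed (fact subS)
    have "\<nu> (core K) \<le> \<nu> (\<Squnion>(core ` ?S))" using core_le_Sup subS by (intro \<nu>_mono) simp_all
    also have "\<dots> = (SUP C\<in>?S. \<nu> (core C))"
      by (simp add: \<nu>_directed_Sup[OF directed] image_image)
    finally have le_SUP: "ennreal (stone_content K) \<le> (SUP C\<in>?S. ennreal (stone_content C))"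
      using K J_compact by (simp add: ennreal_stone_content)
    have member_approx: "\<exists>C\<in>?S. stone_content K - stone_content C < \<epsilon>" if \<epsilon>: "0 < \<epsilon>" for \<epsilon>
    proof (rule ccontr)
      assume "\<not> (\<exists>C\<in>?S. stone_content K - stone_content C < \<epsilon>)"
      then have far: "\<forall>C\<in>?S. \<epsilon> \<le> stone_content K - stone_content C" by (meson not_less)
      then have small: "stone_content C \<le> stone_content K - \<epsilon>" if "C \<in> ?S" for C
        using bspec[OF far that] by linarith
      have "(SUP C\<in>?S. ennreal (stone_content C)) \<le> ennreal (stone_content K - \<epsilon>)"
        by (rule SUP_least) (rule ennreal_leI, rule small)
      then have "ennreal (stone_content K) \<le> ennreal (stone_content K - \<epsilon>)" using le_SUP by (rule order_trans[rotated])
      \<comment> \<open>Without this bound \<open>ennreal\<close> would truncate the difference to \<open>0\<close>.\<close>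
      moreover have "0 \<le> stone_content K - \<epsilon>"
        using small[of "{}"] J_empty stone_content_nonneg[of "{}"] by simp
      ultimately show False using \<epsilon> by simp
    qed
    have approx: "\<exists>F. finite F \<and> F \<subseteq> ?S \<and> stone_content K - stone_content (\<Union>F) < \<epsilon>"
      if \<epsilon>: "0 < \<epsilon>" for \<epsilon>
    proof -
      obtain C where "C \<in> ?S" "stone_content K - stone_content C < \<epsilon>"
        using member_approx[OF \<epsilon>] ..
      then show ?thesis by (intro exI[of _ "{C}"]) simp
    qed
    show "K \<in> J" by (rule J_closed[OF K _ _ approx]) simp_all
  qed
qed

lemma locale_iso_content_locale_stone: "locale_iso L (content_locale stone stone_content)"
proof (rule locale_iso_if_order_iso[where h = ideal_of and k = "\<lambda>J. \<Squnion>(core ` J)"])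
  show "frame L" by (rule frame_axioms)
  show "partial_order (content_locale stone stone_content)"
    by unfold_locales (auto simp: content_locale_def)
  show "ideal_of \<in> carrier L \<rightarrow> carrier (content_locale stone stone_content)"
    by (auto simp: content_locale_def content_ideal_ideal_of)
  show "(\<lambda>J. \<Squnion>(core ` J)) \<in> carrier (content_locale stone stone_content) \<rightarrow> carrier L"
    by (auto intro!: sup_closed)
  show "\<Squnion>(core ` ideal_of U) = U" if "U \<in> carrier L" for U using that by (rule Sup_core_ideal_of)
  show "ideal_of (\<Squnion>(core ` J)) = J" if "J \<in> carrier (content_locale stone stone_content)" for J
    using that by (intro ideal_of_Sup_core) (simp add: content_locale_def)
  show "ideal_of U \<sqsubseteq>\<^bsub>content_locale stone stone_content\<^esub> ideal_of V"
    if "U \<in> carrier L" "V \<in> carrier L" "U \<sqsubseteq> V" for U V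
    using le_trans[of _ U V] that by (auto simp: content_locale_def ideal_of_def)
  show "\<Squnion>(core ` I) \<sqsubseteq> \<Squnion>(core ` J)"
    if "I \<sqsubseteq>\<^bsub>content_locale stone stone_content\<^esub> J" for I J
    using that by (intro sup_least sup_upper) (auto simp: content_locale_def intro!: sup_closed sup_upper)
qed

end

lemma measurable_localeE:
  assumes "measurable_locale L"
  obtains \<nu> where "measured_boolean_frame L \<nu>"
proof -
  obtain \<nu> where \<nu>: "locale_measure L \<nu>" "locally_finite_measure L \<nu>" "faithful_measure L \<nu>"
    using assms unfolding measurable_locale_def by blast
  have "boolean_locale L" using assms by (simp add: measurable_locale_def)
  then have "boolean_frame L"
    unfolding boolean_locale_def boolean_frame_def boolean_frame_axioms_def by blast
  then have "measured_boolean_frame L \<nu>"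
    using \<nu> by (simp add: measured_boolean_frame_def measured_boolean_frame_axioms_def)
  then show thesis by (rule that)
qed

theorem theorem1p16:
  fixes L :: "'a gorder"
  assumes "measurable_locale L"
  shows "\<exists>(X :: 'a set topology) \<mu>.
           locally_compact_space X \<and> Hausdorff_space X \<and> regular_content X \<mu> \<and>
           locale_iso L (content_locale X \<mu>)"
proof -
  obtain \<nu> where "measured_boolean_frame L \<nu>" using assms by (rule measurable_localeE)
  then interpret measured_boolean_frame L \<nu> .
  show ?thesis
    using locally_compact_stone Hausdorff_stone regular_content_stone locale_iso_content_locale_stone
    by blast
qed

end
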